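(* Let $n\ge 2$ be an integer, let $u>0$, let $\mathcal P=\{(x,y,z)\in\mathbb{R}^{n-2}\times\mathbb{R}_+\times\mathbb{R}_+ : \|x\|^2\le 2yz,\ z\le u\}$, and let $(\hat x,\hat y,\hat z)\in\mathbb{R}^{n-2}\times\mathbb{R}\times\mathbb{R}$. Let $\tilde x$ be as defined in the context. Then $P_{\mathcal P}(\hat x,\hat y,\hat z)=\left(\tilde x,\frac{\|\tilde x\|^2}{2u},u\right)$ if and only if all of the following hold: (i) $\hat y\le\frac{\|\tilde x\|^2}{2u}$; (ii) $\|\tilde x\|\le\|\hat x\|$; (iii) $\hat z\ge u-\frac1u\,\tilde x\cdot(\hat x-\tilde x)-\frac{\|\tilde x\|^2}{2u^2}\left(\hat y-\frac{\|\tilde x\|^2}{2u}\right)$.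
   Context: $\|\cdot\|$ is the Euclidean norm and $\cdot$ the dot product. $P_{\mathcal P}(\mathsf w)$ denotes the Euclidean projection of $\mathsf w\in\mathbb{R}^n$ onto the closed convex set $\mathcal P$, i.e. the unique minimizer of $\|\mathsf v-\mathsf w\|$ over $\mathsf v\in\mathcal P$. Points of $\mathbb{R}^n$ are written $(x,y,z)$ with $x\in\mathbb{R}^{n-2}$ and $y,z\in\mathbb{R}$. Given $(\hat x,\hat y,\hat z)$ and $u$, define $$\tilde x=\frac{2u^2}{\alpha^2-2u\hat y+2u^2}\,\hat x,$$ where $\alpha$ is the following solution of the cubic equation $t^3+(2u^2-2u\hat y)t-2u^2\|\hat x\|=0$: $$\alpha=\frac{\sqrt{2u}}{6}A^{1/3}+\sqrt{2u}\,(2\hat y-2u)\,A^{-1/3},\qquad A=54\sqrt{2u}\,\|\hat x\|+6\sqrt{162\|\hat x\|^2u-48\hat y^3+144\hat y^2u-144\hat yu^2+48u^3}.$$ If the quantity under the inner square root is negative, the square root and cube root are taken as principal complex values (the resulting $\alpha$ is real). If $\hat x=0$, then $\tilde x=0$ by convention. *)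

theory Defs
  imports "HOL-Analysis.Analysis"
begin

(* With n = CARD('n), the points of R^n are the vectors of type real^'n.  Two distinct
   coordinates i and j carry the entries y and z, so that n >= 2 automatically, and n = 2
   occurs.  The factor R^(n-2) is the coordinate subspace of vectors vanishing at i and j,
   with the norm and inner product of real^'n; for n = 2 it is {0}. *)

definition xspace :: "'n::finite \<Rightarrow> 'n \<Rightarrow> (real^'n) set" where
  "xspace i j = {x. x $ i = 0 \<and> x $ j = 0}"

(* the point (x, y, z), meant for x in xspace i j *)
definition point :: "'n::finite \<Rightarrow> 'n \<Rightarrow> real^'n \<Rightarrow> real \<Rightarrow> real \<Rightarrow> real^'n" where
  "point i j x y z = x + axis i y + axis j z"

definition \<P> :: "'n::finite \<Rightarrow> 'n \<Rightarrow> real \<Rightarrow> (real^'n) set" where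
  "\<P> i j u = {point i j x y z | x y z.
      x \<in> xspace i j \<and> 0 \<le> y \<and> 0 \<le> z \<and> (norm x)\<^sup>2 \<le> 2 * y * z \<and> z \<le> u}"

(* In the next two definitions h stands for the norm of the given x-part.  Complex csqrt and powr are the
   principal branches; they agree with the real roots when the radicand is nonnegative. *)

definition cardanoA :: "real \<Rightarrow> real \<Rightarrow> real \<Rightarrow> complex" where
  "cardanoA u h y = of_real (54 * sqrt (2 * u) * h) +
     6 * csqrt (of_real (162 * h\<^sup>2 * u - 48 * y^3 + 144 * y\<^sup>2 * u - 144 * y * u\<^sup>2 + 48 * u^3))"

(* For u, h > 0 the complex number inside Re is real: it is the positive root of
   t^3 + (2u^2 - 2uy) t - 2u^2 h. *)
definition alpha :: "real \<Rightarrow> real \<Rightarrow> real \<Rightarrow> real" where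
  "alpha u h y = Re (of_real (sqrt (2 * u) / 6) * cardanoA u h y powr (1/3) +
     of_real (sqrt (2 * u) * (2 * y - 2 * u)) * cardanoA u h y powr (- (1/3)))"

definition xtilde :: "real \<Rightarrow> real^'n::finite \<Rightarrow> real \<Rightarrow> real^'n" where
  "xtilde u x y =
     (if x = 0 then 0
      else (2 * u\<^sup>2 / ((alpha u (norm x) y)\<^sup>2 - 2 * u * y + 2 * u\<^sup>2)) *\<^sub>R x)"

end

theory Submission
  imports Defs
begin

text \<open>
  At a point \<open>p = (x, \<parallel>x\<parallel>\<^sup>2/(2u), u)\<close> the normal cone of \<open>\<P>\<close> is generated by
  \<open>(x, -u, -\<parallel>x\<parallel>\<^sup>2/(2u))\<close>, which is normal to the cone \<open>\<parallel>x\<parallel>\<^sup>2 \<le> 2yz\<close>, and \<open>(0, 0, 1)\<close>, which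
  is normal to the half-space \<open>z \<le> u\<close>.  Hence \<open>p\<close> is the projection of \<open>(xh, yh, zh)\<close> exactly if the difference of the
  two points is \<open>\<lambda>\<close> times the first vector plus \<open>\<mu>\<close> times the second with \<open>\<lambda>, \<mu> \<ge> 0\<close>.
  The second coordinate forces \<open>\<lambda> = (\<parallel>x\<parallel>\<^sup>2/(2u) - yh)/u\<close>, so \<open>\<lambda> \<ge> 0\<close> is condition (i); the
  first coordinate says \<open>xh = (1 + \<lambda>) x\<close>, which then implies (ii); and the third
  coordinate turns \<open>\<mu> \<ge> 0\<close> into (iii).

  The multiplier equation \<open>xh = (1 + \<lambda>) x\<close> is \<open>2u\<^sup>2 xh = (\<parallel>x\<parallel>\<^sup>2 - 2u yh + 2u\<^sup>2) x\<close>, and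
  \<open>xtilde\<close> always solves it: taking norms shows that \<open>\<parallel>x\<parallel>\<close> has to be, up to sign, a
  root of the cubic \<open>t\<^sup>3 + (2u\<^sup>2 - 2u yh) t - 2u\<^sup>2 \<parallel>xh\<parallel>\<close>, and if \<open>xh \<noteq> 0\<close>, then \<open>alpha\<close> is such a
  root by Cardano's formula (\<open>alpha_root\<close>, \<open>xtilde_stationary\<close>).  Given this equation, the equivalence
  (\<open>closest_point_iff_multipliers\<close>) is the variational
  inequality of the projection: its necessity is tested on two points of
  \<open>\<P>\<close> only, and its sufficiency is Cauchy-Schwarz combined with the inequality between
  the arithmetic and geometric mean.
\<close>

section \<open>Cardano's formula\<close>

text \<open>
  The summands \<open>v\<close> and \<open>-p/(3v)\<close> of Cardano's formula have product \<open>-p/3\<close>, and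
  their cubes are \<open>-q/2 + d\<close> and, because \<open>(-q/2 + d)(-q/2 - d) = (-p/3)\<^sup>3\<close>, also \<open>-q/2 - d\<close>,
  which add up to \<open>-q\<close>; expanding the cube of the sum then gives the cubic.
\<close>

lemma cardano_root:
  fixes p q d v :: complex
  assumes d: "d\<^sup>2 = q\<^sup>2 / 4 + (p / 3) ^ 3" and v: "v ^ 3 = - q / 2 + d" and "v \<noteq> 0"
  shows "(v - p / (3 * v)) ^ 3 + p * (v - p / (3 * v)) + q = 0"
proof -
  define w where "w = - p / (3 * v)"
  have p: "p = - 3 * v * w"
    using \<open>v \<noteq> 0\<close> by (simp add: w_def)
  have "v ^ 3 * (w ^ 3 + q / 2 + d) = (v * w) ^ 3 + v ^ 3 * (q / 2 + d)"
    by (simp add: algebra_simps power_mult_distrib)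
  also have "\<dots> = (v * w) ^ 3 + (d\<^sup>2 - q\<^sup>2 / 4)"
    unfolding v by (simp add: algebra_simps power2_eq_square)
  also have "\<dots> = 0"
    unfolding d p by (simp add: power3_eq_cube)
  finally have "w ^ 3 + q / 2 + d = 0"
    using \<open>v \<noteq> 0\<close> by simp
  then have w: "w ^ 3 = - q / 2 - d"
    by (simp add: add_eq_0_iff)
  have "(v + w) ^ 3 + p * (v + w) + q = v ^ 3 + w ^ 3 + q"
    unfolding p by (simp add: power3_eq_cube algebra_simps)
  also have "\<dots> = 0"
    unfolding v w by simp
  finally show ?thesis
    by (simp add: w_def)
qed

text \<open>
  In the casus irreducibilis the number \<open>d\<close> is imaginary, so
  \<open>\<bar>v\<bar>\<^sup>6 = q\<^sup>2/4 - d\<^sup>2 = (-p/3)\<^sup>3\<close>.  Therefore the two summands of Cardano's formula,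
  whose product is \<open>-p/3\<close>, are conjugate, and this for every choice of the cube root \<open>v\<close>.
\<close>

lemma cardano_real_if_irreducible:
  fixes p q :: real and d v :: complex
  assumes d: "d\<^sup>2 = of_real (q\<^sup>2 / 4 + (p / 3) ^ 3)" and v: "v ^ 3 = - of_real q / 2 + d"
    and neg: "q\<^sup>2 / 4 + (p / 3) ^ 3 < 0"
  shows "v - of_real p / (3 * v) \<in> \<real>"
proof (cases "v = 0")
  case False
  have Re: "(Re d)\<^sup>2 - (Im d)\<^sup>2 = q\<^sup>2 / 4 + (p / 3) ^ 3" and "Re d * Im d = 0"
    using d by (auto simp: complex_eq_iff power2_eq_square)
  moreover have "Im d \<noteq> 0"
    using Re neg zero_le_power2[of "Re d"] by (smt (verit) zero_power2)
  ultimately have "Re d = 0" and Im: "(Im d)\<^sup>2 = - (q\<^sup>2 / 4) - (p / 3) ^ 3"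
    by auto
  have "((cmod v)\<^sup>2) ^ 3 = (cmod (v ^ 3))\<^sup>2"
    by (simp add: norm_power mult.commute flip: power_mult)
  also have "\<dots> = q\<^sup>2 / 4 + (Im d)\<^sup>2"
    unfolding v cmod_power2 using \<open>Re d = 0\<close> by (simp add: power_divide)
  also have "\<dots> = (- p / 3) ^ 3"
    unfolding Im by (simp add: power3_eq_cube)
  finally have "((cmod v)\<^sup>2) ^ 3 = (- p / 3) ^ 3" .
  moreover have "(p / 3) ^ 3 < 0"
    using neg zero_le_power2[of q] by linarith
  then have "0 \<le> - p / 3"
    using zero_le_power[of "p / 3" 3] by linarith
  ultimately have "(cmod v)\<^sup>2 = - p / 3"
    by (metis power_eq_iff_eq_base zero_le_power2 zero_less_numeral)
  then have "v * cnj v = of_real (- p / 3)"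
    by (simp add: complex_norm_square[symmetric])
  then have "v - of_real p / (3 * v) = v + cnj v"
    using False by (simp add: field_simps)
  then show ?thesis
    by (simp add: complex_add_cnj)
qed simp

text \<open>
  With \<open>p = 2u(u - y)\<close> and \<open>q = -2u\<^sup>2 h\<close>, Cardano's cube root is \<open>v = sqrt (2u)/6\<close> times the
  principal cube root of \<open>cardanoA\<close>.  Since \<open>h > 0\<close>, \<open>cardanoA\<close> has positive real part, so \<open>v\<close> is
  nonzero.  The radicand is a positive multiple of the discriminant \<open>q\<^sup>2/4 + (p/3)\<^sup>3\<close>: if it
  is nonnegative, \<open>cardanoA\<close> and its principal cube root are real; otherwise the
  preceding lemma applies.  So passing to the real part in \<open>alpha\<close> loses nothing.
\<close>

lemma alpha_root:
  fixes u h y :: real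
  assumes "u > 0" and "h > 0"
  shows "(alpha u h y) ^ 3 + (2 * u\<^sup>2 - 2 * u * y) * alpha u h y - 2 * u\<^sup>2 * h = 0"
proof -
  define s where "s = sqrt (2 * u)"
  define r where "r = 162 * h\<^sup>2 * u - 48 * y^3 + 144 * y\<^sup>2 * u - 144 * y * u\<^sup>2 + 48 * u^3"
  define A where "A = cardanoA u h y"
  define B where "B = A powr (1/3)"
  define p where "p = 2 * u\<^sup>2 - 2 * u * y"
  define q where "q = - 2 * u\<^sup>2 * h"
  define v where "v = of_real (s / 6) * B"
  define d where "d = of_real (s ^ 3 / 36) * csqrt (of_real r)"
  have "s > 0" and s2: "s\<^sup>2 = 2 * u"
    using \<open>u > 0\<close> by (simp_all add: s_def)
  have s3: "s ^ 3 = 2 * u * s" and s4: "s ^ 4 = 4 * u\<^sup>2"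
    using s2 by (simp_all add: power3_eq_cube power4_eq_xxxx power2_eq_square)
  have A: "A = of_real (54 * s * h) + 6 * csqrt (of_real r)"
    by (simp add: A_def cardanoA_def s_def r_def)
  have "Re A > 0"
    unfolding A using \<open>s > 0\<close> \<open>h > 0\<close> Re_csqrt[of "of_real r"]
    by (simp add: add_pos_nonneg del: csqrt_of_real_nonneg csqrt_of_real_nonpos)
  then have "A \<noteq> 0"
    by auto
  then have "B \<noteq> 0"
    by (simp add: B_def)
  have B3: "B ^ 3 = A"
    using \<open>A \<noteq> 0\<close> by (simp add: B_def powr_def flip: exp_of_nat_mult)
  have "v \<noteq> 0"
    using \<open>B \<noteq> 0\<close> \<open>s > 0\<close> by (simp add: v_def)
  have disc: "(s ^ 3 / 36)\<^sup>2 * r = q\<^sup>2 / 4 + (p / 3) ^ 3"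
    unfolding s3 power_divide power_mult_distrib s2
    by (simp add: r_def p_def q_def power2_eq_square power3_eq_cube field_simps)
  have d: "d\<^sup>2 = of_real (q\<^sup>2 / 4 + (p / 3) ^ 3)"
    unfolding disc[symmetric] d_def power_mult_distrib power2_csqrt
    by simp
  have "v ^ 3 = of_real (s ^ 3 / 216) * A"
    by (simp add: v_def power_mult_distrib B3 power_divide)
  also have "\<dots> = of_real (s ^ 4 * h / 4) + d"
    unfolding A d_def by (simp add: algebra_simps power3_eq_cube power4_eq_xxxx)
  finally have v: "v ^ 3 = - of_real q / 2 + d"
    by (simp add: s4 q_def)
  define k where "k = s * (2 * y - 2 * u)"
  have "p = - k * (s / 2)"
  proof -
    have "- k * (s / 2) = s\<^sup>2 * (u - y)"
      by (simp add: k_def power2_eq_square algebra_simps)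
    then show ?thesis
      unfolding s2 p_def by (simp add: power2_eq_square algebra_simps)
  qed
  then have p: "complex_of_real p = - of_real k * (of_real s / 2)"
    by simp
  have "of_real k * A powr (- (1/3)) = - (of_real p / (3 * v))"
    unfolding powr_minus B_def[symmetric] v_def p using \<open>B \<noteq> 0\<close> \<open>s > 0\<close>
    by (simp add: divide_simps)
  then have alpha: "alpha u h y = Re (v - of_real p / (3 * v))"
    by (simp add: alpha_def v_def s_def k_def A_def B_def)
  have "v - of_real p / (3 * v) \<in> \<real>"
  proof (cases "r \<ge> 0")
    case True
    then have "A \<in> \<real>\<^sub>\<ge>\<^sub>0"
      unfolding A using \<open>s > 0\<close> \<open>h > 0\<close>
      by (simp add: complex_nonneg_Reals_iff)
    then have "B \<in> \<real>"
      by (auto simp: B_def nonneg_Reals_def powr_Reals_eq)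
    then show ?thesis
      by (auto simp: v_def)
  next
    case False
    have "(s ^ 3 / 36)\<^sup>2 * r < 0"
      using False \<open>s > 0\<close> by (simp add: mult_pos_neg)
    then show ?thesis
      using cardano_real_if_irreducible d v disc by simp
  qed
  then have real: "complex_of_real (alpha u h y) = v - of_real p / (3 * v)"
    unfolding alpha by (rule of_real_Re)
  have "d\<^sup>2 = (of_real q)\<^sup>2 / 4 + (of_real p / 3) ^ 3"
    unfolding d by simp
  then have "complex_of_real (alpha u h y ^ 3 + p * alpha u h y + q) = 0"
    using cardano_root[OF _ v \<open>v \<noteq> 0\<close>, of "of_real p"]
    unfolding of_real_add of_real_mult of_real_power real by blast
  then have "alpha u h y ^ 3 + p * alpha u h y + q = 0"
    by (simp only: of_real_eq_0_iff)
  then show ?thesis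
    by (simp add: p_def q_def)
qed

text \<open>
  If \<open>xh \<noteq> 0\<close>, the cubic says \<open>alpha * D = 2u\<^sup>2 \<parallel>xh\<parallel>\<close> for the denominator \<open>D\<close> of
  \<open>xtilde\<close>; so \<open>D \<noteq> 0\<close>, and \<open>\<parallel>xtilde\<parallel> = \<bar>alpha\<bar>\<close>.
\<close>

lemma xtilde_stationary:
  fixes xh :: "real^'n::finite" and yh u :: real
  assumes "u > 0"
  defines "x \<equiv> xtilde u xh yh"
  shows "((norm x)\<^sup>2 - 2 * u * yh + 2 * u\<^sup>2) *\<^sub>R x = (2 * u\<^sup>2) *\<^sub>R xh"
proof (cases "xh = 0")
  case True
  then show ?thesis by (simp add: x_def xtilde_def)
next
  case False
  define a where "a = alpha u (norm xh) yh"
  define D where "D = a\<^sup>2 - 2 * u * yh + 2 * u\<^sup>2"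
  have x: "x = (2 * u\<^sup>2 / D) *\<^sub>R xh"
    using False by (simp add: x_def xtilde_def a_def D_def)
  have aD: "a * D = 2 * u\<^sup>2 * norm xh"
    using alpha_root[of u "norm xh" yh] False \<open>u > 0\<close>
    by (simp add: a_def D_def power3_eq_cube power2_eq_square algebra_simps)
  then have "D \<noteq> 0"
    using False \<open>u > 0\<close> by auto
  then have "a = 2 * u\<^sup>2 / D * norm xh"
    using aD by (simp add: field_simps)
  then have "(norm x)\<^sup>2 = a\<^sup>2"
    by (simp add: x power_mult_distrib power_divide)
  then show ?thesis
    using \<open>D \<noteq> 0\<close> by (simp add: x flip: D_def)
qed

section \<open>The variational inequality over the truncated cone\<close>

lemma inner_point:
  fixes i j :: "'n::finite"
  assumes "i \<noteq> j" and "x \<in> xspace i j" and "x' \<in> xspace i j"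
  shows "point i j x y z \<bullet> point i j x' y' z' = x \<bullet> x' + y * y' + z * z'"
proof -
  have "axis i y $ j = 0" "axis j z $ i = 0"
    using \<open>i \<noteq> j\<close> by (simp_all add: axis_def)
  then show ?thesis
    using assms by (simp add: point_def xspace_def inner_add_left inner_add_right inner_axis inner_axis')
qed

lemma diff_point:
  "point i j x y z - point i j x' y' z' = point i j (x - x') (y - y') (z - z')"
  by (simp add: point_def vec_eq_iff axis_def)

lemma point_in_\<P>:
  assumes "x \<in> xspace i j" "0 \<le> y" "0 \<le> z" "(norm x)\<^sup>2 \<le> 2 * y * z" "z \<le> u"
  shows "point i j x y z \<in> \<P> i j u"
  using assms unfolding \<P>_def by blast

lemma xspace_diff: "x \<in> xspace i j \<Longrightarrow> x' \<in> xspace i j \<Longrightarrow> x - x' \<in> xspace i j"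
  by (simp add: xspace_def)

text \<open>
  Adding \<open>y\<^sup>2 + z\<^sup>2\<close> to both sides turns \<open>\<parallel>x\<parallel>\<^sup>2 \<le> 2yz\<close> into \<open>\<parallel>(x, y, z)\<parallel>\<^sup>2 \<le> (y + z)\<^sup>2\<close>.  In this
  form every constraint bounds a continuous convex function by an affine one, so \<open>\<P>\<close> is closed and convex.
\<close>

lemma \<P>_eq:
  fixes i j :: "'n::finite"
  assumes "i \<noteq> j"
  shows "\<P> i j u = {v. norm v \<le> v $ i + v $ j} \<inter> {v. 0 \<le> v $ i} \<inter> {v. 0 \<le> v $ j} \<inter> {v. v $ j \<le> u}"
    (is "_ = ?R")
proof -
  have coords: "point i j x y z $ i = y" "point i j x y z $ j = z" if "x \<in> xspace i j" for x y z
    using that assms by (simp_all add: point_def xspace_def axis_def)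
  have cone: "norm (point i j x y z) \<le> y + z \<longleftrightarrow> (norm x)\<^sup>2 \<le> 2 * y * z"
    if "x \<in> xspace i j" "0 \<le> y" "0 \<le> z" for x y z
  proof -
    have "norm (point i j x y z) \<le> y + z \<longleftrightarrow> (norm (point i j x y z))\<^sup>2 \<le> (y + z)\<^sup>2"
      using that by (simp add: power2_le_iff_abs_le)
    then show ?thesis
      using that assms
      by (simp add: power2_norm_eq_inner inner_point power2_sum) (simp add: power2_eq_square)
  qed
  have decomp: "\<exists>x \<in> xspace i j. v = point i j x (v $ i) (v $ j)" for v
    using assms
    by (intro bexI[of _ "v - axis i (v $ i) - axis j (v $ j)"]) (auto simp: point_def xspace_def axis_def)
  show ?thesis
  proof (rule set_eqI)
    fix v
    obtain x where x: "x \<in> xspace i j" "v = point i j x (v $ i) (v $ j)"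
      using decomp by blast
    show "v \<in> \<P> i j u \<longleftrightarrow> v \<in> ?R"
    proof
      assume "v \<in> \<P> i j u"
      then show "v \<in> ?R"
        by (auto simp: \<P>_def coords cone)
    next
      assume "v \<in> ?R"
      then show "v \<in> \<P> i j u"
        using x cone[OF x(1), of "v $ i" "v $ j"] unfolding \<P>_def by auto
    qed
  qed
qed

lemma closed_\<P>: "i \<noteq> j \<Longrightarrow> closed (\<P> i j u)"
  unfolding \<P>_eq by (intro closed_Int closed_Collect_le continuous_intros)

lemma convex_\<P>:
  fixes i j :: "'n::finite"
  assumes "i \<noteq> j" shows "convex (\<P> i j u)"
proof -
  have cone: "norm (a *\<^sub>R v + b *\<^sub>R w) \<le> (a *\<^sub>R v + b *\<^sub>R w) $ i + (a *\<^sub>R v + b *\<^sub>R w) $ j"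
    if "norm v \<le> v $ i + v $ j" "norm w \<le> w $ i + w $ j" "0 \<le> a" "0 \<le> b"
    for v w :: "real^'n" and a b :: real
  proof -
    have "norm (a *\<^sub>R v + b *\<^sub>R w) \<le> a * norm v + b * norm w"
      using norm_triangle_ineq[of "a *\<^sub>R v" "b *\<^sub>R w"] that by simp
    also have "\<dots> \<le> a * (v $ i + v $ j) + b * (w $ i + w $ j)"
      using that by (intro add_mono mult_left_mono)
    finally show ?thesis by (simp add: algebra_simps)
  qed
  show ?thesis
    unfolding \<P>_eq[OF assms]
    by (intro convex_Int) 
      (auto simp: convex_def convex_bound_le intro: cone[simplified])
qed

lemma closest_point_eq_iff_inner_le_0:
  fixes S :: "'a::euclidean_space set"
  assumes "convex S" "closed S" "p \<in> S"
  shows "closest_point S w = p \<longleftrightarrow> (\<forall>q\<in>S. (w - p) \<bullet> (q - p) \<le> 0)"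
proof
  assume "closest_point S w = p"
  then show "\<forall>q\<in>S. (w - p) \<bullet> (q - p) \<le> 0"
    using closest_point_dot[OF assms(1,2)] by blast
next
  assume obtuse: "\<forall>q\<in>S. (w - p) \<bullet> (q - p) \<le> 0"
  have "dist w p \<le> dist w q" if "q \<in> S" for q
  proof -
    have "(norm (w - q))\<^sup>2 = (norm (w - p))\<^sup>2 + (norm (q - p))\<^sup>2 - 2 * ((w - p) \<bullet> (q - p))"
      by (simp add: power2_norm_eq_inner inner_diff_left inner_diff_right inner_commute)
    also have "\<dots> \<ge> (norm (w - p))\<^sup>2"
      using obtuse that by (smt (verit) zero_le_power2)
    finally show ?thesis
      by (simp add: dist_norm)
  qed
  then show "closest_point S w = p"
    using closest_point_unique[OF assms] by simp
qed

text \<open>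
  Here \<open>l\<close> is the multiplier of \<open>\<parallel>x\<parallel>\<^sup>2/2 \<le> yz\<close>, and the third coordinate of the multiplier
  equations makes \<open>zh - u + l * \<parallel>x\<parallel>\<^sup>2/(2u)\<close> that of \<open>z \<le> u\<close>.
\<close>

lemma closest_point_iff_multipliers:
  fixes i j :: "'n::finite" and x xh :: "real^'n"
  assumes "i \<noteq> j" and "u > 0" and x: "x \<in> xspace i j"
    and xh: "xh = (1 + l) *\<^sub>R x" and yh: "yh = (norm x)\<^sup>2 / (2 * u) - l * u"
  shows "closest_point (\<P> i j u) (point i j xh yh zh) = point i j x ((norm x)\<^sup>2 / (2 * u)) u
    \<longleftrightarrow> 0 \<le> l \<and> u - l * ((norm x)\<^sup>2 / (2 * u)) \<le> zh"
proof -
  define y where "y = (norm x)\<^sup>2 / (2 * u)"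
  define w where "w = point i j xh yh zh"
  define p where "p = point i j x y u"
  have nx: "(norm x)\<^sup>2 = 2 * y * u" and "y \<ge> 0"
    using \<open>u > 0\<close> by (simp_all add: y_def)
  have "xh \<in> xspace i j"
    using x by (simp add: xh xspace_def)
  have "p \<in> \<P> i j u"
    unfolding p_def using x \<open>u > 0\<close> \<open>y \<ge> 0\<close> nx by (intro point_in_\<P>) auto
  have inner: "(w - p) \<bullet> (point i j x' y' z' - p)
      = l * (x \<bullet> x' - u * y' - y * z') + (zh - u + l * y) * (z' - u)"
    if "x' \<in> xspace i j" for x' y' z'
  proof -
    have "(w - p) \<bullet> (point i j x' y' z' - p)
        = (xh - x) \<bullet> (x' - x) + (yh - y) * (y' - y) + (zh - u) * (z' - u)"
      using that x \<open>xh \<in> xspace i j\<close> \<open>i \<noteq> j\<close>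
      by (simp add: w_def p_def diff_point inner_point xspace_diff)
    also have "(xh - x) \<bullet> (x' - x) = l * (x \<bullet> x' - 2 * y * u)"
      by (simp add: xh scaleR_left_distrib inner_diff_right power2_norm_eq_inner[symmetric] nx right_diff_distrib)
    finally show ?thesis
      by (simp add: yh flip: y_def) (simp add: algebra_simps)
  qed
  have "(\<forall>q\<in>\<P> i j u. (w - p) \<bullet> (q - p) \<le> 0) \<longleftrightarrow> 0 \<le> l \<and> u - l * y \<le> zh" (is "?VI \<longleftrightarrow> ?KKT")
  proof
    assume VI: ?VI
    \<comment> \<open>Raising \<open>y\<close> alone stays in the plane \<open>z = u\<close>, so that only \<open>l\<close> contributes; the
       segment from \<open>p\<close> to the apex stays on the boundary of the cone, so that only the other
       multiplier contributes.\<close>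
    have "point i j x (y + 1) u \<in> \<P> i j u"
      using x \<open>u > 0\<close> \<open>y \<ge> 0\<close> nx by (intro point_in_\<P>) (auto simp: algebra_simps)
    then have "l * (x \<bullet> x - u * (y + 1) - y * u) \<le> 0"
      using VI inner[OF x, of "y + 1" u] by auto
    then have "0 \<le> l"
      using \<open>u > 0\<close> by (simp add: power2_norm_eq_inner[symmetric] nx algebra_simps zero_le_mult_iff)
    moreover have "0 \<in> xspace i j"
      by (simp add: xspace_def)
    moreover have "point i j 0 0 0 \<in> \<P> i j u"
      using \<open>0 \<in> xspace i j\<close> \<open>u > 0\<close> by (intro point_in_\<P>) auto
    ultimately have "(zh - u + l * y) * (0 - u) \<le> 0"
      using VI inner[of 0 0 0] by auto
    then show ?KKT
      using \<open>0 \<le> l\<close> \<open>u > 0\<close> by (simp add: mult_le_0_iff zero_le_mult_iff)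
  next
    assume KKT: ?KKT
    show ?VI
    proof
      fix q assume "q \<in> \<P> i j u"
      then obtain x' y' z' where q: "q = point i j x' y' z'" "x' \<in> xspace i j"
        and nonneg: "0 \<le> y'" "0 \<le> z'" and cone: "(norm x')\<^sup>2 \<le> 2 * y' * z'" and "z' \<le> u"
        by (auto simp: \<P>_def)
      \<comment> \<open>This is self-duality of the cone \<open>\<parallel>x\<parallel>\<^sup>2 \<le> 2yz\<close>, \<open>y, z \<ge> 0\<close>: both \<open>q\<close> and \<open>(-x, u, y)\<close>
         lie in it, so their inner product is nonnegative.\<close>
      have "x \<bullet> x' \<le> u * y' + y * z'"
      proof (rule power2_le_imp_le)
        have "(x \<bullet> x')\<^sup>2 \<le> (norm x)\<^sup>2 * (norm x')\<^sup>2"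
          using Cauchy_Schwarz_ineq[of x x'] by (simp add: power2_norm_eq_inner)
        also have "\<dots> \<le> (2 * y * u) * (2 * y' * z')"
          unfolding nx using cone \<open>u > 0\<close> \<open>y \<ge> 0\<close> by (intro mult_left_mono) auto
        also have "\<dots> \<le> (u * y' + y * z')\<^sup>2"
          using zero_le_power2[of "u * y' - y * z'"] by (simp add: power2_eq_square algebra_simps)
        finally show "(x \<bullet> x')\<^sup>2 \<le> (u * y' + y * z')\<^sup>2" .
        show "0 \<le> u * y' + y * z'"
          using nonneg \<open>u > 0\<close> \<open>y \<ge> 0\<close> by simp
      qed
      then have "l * (x \<bullet> x' - u * y' - y * z') \<le> 0"
        using KKT by (simp add: mult_nonneg_nonpos)
      moreover have "(zh - u + l * y) * (z' - u) \<le> 0"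
        using KKT \<open>z' \<le> u\<close> by (intro mult_nonneg_nonpos) auto
      ultimately show "(w - p) \<bullet> (q - p) \<le> 0"
        using inner[OF q(2)] q(1) by simp
    qed
  qed
  then show ?thesis
    using closest_point_eq_iff_inner_le_0[OF convex_\<P> closed_\<P> \<open>p \<in> \<P> i j u\<close>] \<open>i \<noteq> j\<close>
    by (simp add: w_def p_def flip: y_def)
qed

section \<open>The projection onto the truncated cone\<close>

theorem corollary4:
  fixes i j :: "'n::finite" and xh xt :: "real^'n" and yh zh u :: real
  assumes "i \<noteq> j" and "u > 0" and "xh \<in> xspace i j"
  defines "xt \<equiv> xtilde u xh yh"
  shows "closest_point (\<P> i j u) (point i j xh yh zh) = point i j xt ((norm xt)\<^sup>2 / (2 * u)) u
    \<longleftrightarrow>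
      yh \<le> (norm xt)\<^sup>2 / (2 * u) \<and>
      norm xt \<le> norm xh \<and>
      zh \<ge> u - 1 / u * (xt \<bullet> (xh - xt))
              - (norm xt)\<^sup>2 / (2 * u\<^sup>2) * (yh - (norm xt)\<^sup>2 / (2 * u))"
proof -
  define l where "l = ((norm xt)\<^sup>2 / (2 * u) - yh) / u"
  have yh: "yh = (norm xt)\<^sup>2 / (2 * u) - l * u"
    using \<open>u > 0\<close> by (simp add: l_def)
  have coeff: "(norm xt)\<^sup>2 - 2 * u * yh + 2 * u\<^sup>2 = (2 * u\<^sup>2) * (1 + l)"
    using \<open>u > 0\<close> by (simp add: l_def field_simps power2_eq_square)
  have "(2 * u\<^sup>2) *\<^sub>R ((1 + l) *\<^sub>R xt) = (2 * u\<^sup>2) *\<^sub>R xh"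
    using xtilde_stationary[OF \<open>u > 0\<close>, of xh yh, folded xt_def] unfolding coeff by simp
  then have xh: "xh = (1 + l) *\<^sub>R xt"
    using \<open>u > 0\<close> by (metis scaleR_cancel_left mult_eq_0_iff power_eq_0_iff zero_neq_numeral less_irrefl)
  have "xt \<in> xspace i j"
    using \<open>xh \<in> xspace i j\<close> by (simp add: xt_def xtilde_def xspace_def)
  note projection = closest_point_iff_multipliers[OF \<open>i \<noteq> j\<close> \<open>u > 0\<close> this xh yh]
  have cond_i: "yh \<le> (norm xt)\<^sup>2 / (2 * u) \<longleftrightarrow> 0 \<le> l"
    using \<open>u > 0\<close> by (simp add: l_def zero_le_divide_iff)
  have cond_ii: "norm xt \<le> norm xh" if "0 \<le> l"
    using that mult_right_mono[of 1 "1 + l" "norm xt"] by (simp add: xh)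
  have "xt \<bullet> (xh - xt) = l * (norm xt)\<^sup>2"
    by (simp add: xh scaleR_left_distrib power2_norm_eq_inner)
  then have "1 / u * (xt \<bullet> (xh - xt)) + (norm xt)\<^sup>2 / (2 * u\<^sup>2) * (yh - (norm xt)\<^sup>2 / (2 * u))
      = l * ((norm xt)\<^sup>2 / (2 * u))"
    using \<open>u > 0\<close> by (simp add: yh power2_eq_square field_simps)
  then have cond_iii: "u - 1 / u * (xt \<bullet> (xh - xt))
        - (norm xt)\<^sup>2 / (2 * u\<^sup>2) * (yh - (norm xt)\<^sup>2 / (2 * u)) \<le> zh
      \<longleftrightarrow> u - l * ((norm xt)\<^sup>2 / (2 * u)) \<le> zh"
    by linarith
  show ?thesis
    unfolding projection cond_i cond_iii using cond_ii by blast
qed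

end
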